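(* Let $(\mathbf G,\mathbf G')=(\mathrm O^\epsilon_{2n},\mathrm{Sp}_{2n'})$ or $(\mathrm{Sp}_{2n},\mathrm O^\epsilon_{2n'})$, and let $\delta$ be such that $\mathcal S_{n,\delta}\subset\mathcal S_{\mathbf G}$ and $\tau=0$. Then the mapping $\overline\theta_{\mathbf G'}\colon\mathcal S_{n,\delta}\to\mathcal S_{n',\delta'}$ is given by $$\binom{a_1,a_2,\dots,a_{m_1}}{b_1,b_2,\dots,b_{m_2}}\mapsto\begin{cases}\binom{b_1+1,b_2+1,\dots,b_{m_2}+1,0}{a_1,a_2,\dots,a_{m_1}},&\text{if }\epsilon=+;\\[2mm]\binom{b_1,b_2,\dots,b_{m_2}}{a_1+1,a_2+1,\dots,a_{m_1}+1,0},&\text{if }\epsilon=-,\end{cases}$$ i.e. $\underline\theta_{\mathbf G'}(\Lambda)=\overline\theta_{\mathbf G'}(\Lambda)$ for all $\Lambda\in\mathcal S_{n,\delta}$.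
   Context: **Symbols.** A $\beta$-set is a finite set of non-negative integers in strictly decreasing order. A symbol is an ordered pair $\Lambda=\binom AB$ of $\beta$-sets, taken modulo the equivalence generated by $\binom{a_1,\dots,a_{m_1}}{b_1,\dots,b_{m_2}}\sim\binom{a_1+1,\dots,a_{m_1}+1,0}{b_1+1,\dots,b_{m_2}+1,0}$ (each class has a unique reduced representative, with $0\notin A\cap B$). $\mathrm{rk}(\Lambda)=\sum_{a\in A}a+\sum_{b\in B}b-\lfloor(\frac{|A|+|B|-1}{2})^2\rfloor$, $\mathrm{def}(\Lambda)=|A|-|B|$. $\mathcal S_{n,\delta}$ is the set of symbols of rank $n$ and defect $\delta$. $\mathcal S_{\mathrm{Sp}_{2n}},\mathcal S_{\mathrm O^+_{2n}},\mathcal S_{\mathrm O^-_{2n}}$ are the sets of symbols of rank $n$ and defect $\equiv1,0,2\pmod 4$ respectively (parametrizing the unipotent characters of these finite groups over $\mathbb F_q$, $q$ odd). $\Upsilon(\Lambda)=\begin{bmatrix}\lambda\\\mu\end{bmatrix}$ is the bi-partition with $\lambda_i=a_i-(m_1-i)$, $\mu_j=b_j-(m_2-j)$; write $\Upsilon(\Lambda)^*=\lambda$, $\Upsilon(\Lambda)_*=\mu$. Partitions are considered up to trailing zeros, $\|\cdot\|$ is the sum of parts, $\cup$ is multiset union of parts. **$\Theta$.** For $\Lambda\in\mathcal S_{n,\delta}\subset\mathcal S_{\mathbf G}$ write $\delta=4d+1,4d,4d+2$ for $\mathbf G=\mathrm{Sp}_{2n},\mathrm O^+_{2n},\mathrm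 O^-_{2n}$ respectively. Put $\delta'=-\delta+1$, $\tau=n'-n+2d$ if $\epsilon=+$; $\delta'=-\delta-1$, $\tau=n'-n-1-2d$ if $\epsilon=-$. With $\Upsilon(\Lambda)=\begin{bmatrix}\lambda\\\mu\end{bmatrix}$, $\Theta_{\mathbf G'}(\Lambda)$ is the set of $\Lambda'\in\mathcal S_{n',\delta'}$, $\Upsilon(\Lambda')=\begin{bmatrix}\lambda'\\\mu'\end{bmatrix}$, such that for all $i$: if $\epsilon=+$, $\lambda'_{i+1}\le\mu_i\le\lambda'_i$ and $\lambda_{i+1}\le\mu'_i\le\lambda_i$; if $\epsilon=-$, $\mu'_{i+1}\le\lambda_i\le\mu'_i$ and $\mu_{i+1}\le\lambda'_i\le\mu_i$. **Order of a symbol.** $\mathrm{ord}(\Lambda)$ is the degree in $q$ of the corresponding unipotent character $\rho_\Lambda(1)$; explicitly, for $\Lambda=\binom{a_1,\dots,a_{m_1}}{b_1,\dots,b_{m_2}}\in\mathcal S_{\mathbf G}$, $m=m_1+m_2$, $$\mathrm{ord}(\Lambda)=N+\sum_i(m_1-i)a_i+\sum_j(m_2-j)b_j+\sum_{i,j}\max(a_i,b_j)-\sum_ia_i(a_i+1)-\sum_jb_j(b_j+1)-\textstyle\binom{m-2}2-\binom{m-4}2-\cdots,$$ with $N=n(n+1)$ for $\mathrm{Sp}_{2n}$ and $N=n^2$ for $\mathrm O^\pm_{2n}$. **$\underline\theta$ and $\overline\theta$ (for $\tau\ge0$).** $\underline\theta_{\mathbf G'}(\Lambda)=\theta_0(\Lambda)$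 is the symbol in $\mathcal S_{n',\delta'}$ with $\Upsilon(\theta_0(\Lambda))=\begin{bmatrix}\mu\cup[\tau]\\\lambda\end{bmatrix}$ if $\epsilon=+$, $\begin{bmatrix}\mu\\\lambda\cup[\tau]\end{bmatrix}$ if $\epsilon=-$. Linear order on $\mathcal S_{n,\delta}$ (and likewise on $\mathcal S_{n',\delta'}$): for $\epsilon=+$, compare first $\|\Upsilon(\cdot)^*\|$, then $\Upsilon(\cdot)^*$ lexicographically, then $\Upsilon(\cdot)_*$ lexicographically; for $\epsilon=-$, compare first $\|\Upsilon(\cdot)_*\|$, then $\Upsilon(\cdot)_*$ lexicographically, then $\Upsilon(\cdot)^*$ lexicographically. Inductively, $\overline\theta_{\mathbf G'}(\Lambda)$ is the smallest element in the set of elements of maximal order $\mathrm{ord}$ in $\Theta^\flat_{\mathbf G'}(\Lambda)=\Theta_{\mathbf G'}(\Lambda)\smallsetminus\{\overline\theta_{\mathbf G'}(\Lambda_1):\Lambda_1\in\mathcal S_{n,\delta},\Lambda_1<\Lambda\}$ (a non-empty set). *)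

theory Defs
  imports Complex_Main "HOL-Library.FSet" "HOL-Library.Multiset_Order"
begin

section \<open>Symbols\<close>

text \<open>
  A beta-set is a finite set of natural numbers.  Its entries
  \<open>a\<^sub>1 > \<dots> > a\<^sub>m\<close> form the decreasing list \<open>entries A\<close>; list
  positions are counted from 0, so \<open>a\<^sub>i\<close> is \<open>entries A ! (i - 1)\<close>, and
  the weight \<open>m - i\<close> becomes \<open>m - 1 - k\<close> at list position \<open>k\<close>.
\<close>

type_synonym beta_set = "nat fset"

definition entries :: "beta_set \<Rightarrow> nat list" where
  "entries A = rev (sorted_list_of_fset A)"

definition shift :: "beta_set \<Rightarrow> beta_set" where
  "shift A = finsert 0 (Suc |`| A)"

inductive shift_step :: "beta_set \<times> beta_set \<Rightarrow> beta_set \<times> beta_set \<Rightarrow> bool" where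
  "shift_step (A, B) (shift A, shift B)"

quotient_type symbol = "beta_set \<times> beta_set" / "equivclp shift_step"
  by (rule equivp_evquivclp)

lift_definition Symbol :: "beta_set \<Rightarrow> beta_set \<Rightarrow> symbol" is "\<lambda>A B. (A, B)" .

lemma equivclp_shift_step_invariant:
  assumes "equivclp shift_step x y"
    and "\<And>A B. f (shift A) (shift B) = f A B"
  shows "case_prod f x = case_prod f y"
  using assms(1)
  by (induction rule: equivclp_induct) (auto elim!: shift_step.cases simp: assms(2))

lemma length_entries [simp]: "length (entries A) = fcard A"
  by (simp add: entries_def sorted_list_of_fset.rep_eq fcard.rep_eq)

lemma set_entries [simp]: "set (entries A) = fset A"
  by (simp add: entries_def)

lemma sorted_entries: "sorted_wrt (>) (entries A)"
  by (simp add: entries_def sorted_list_of_fset.rep_eq sorted_wrt_rev)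

lemma entries_unique:
  assumes "sorted_wrt (>) xs" "set xs = fset A"
  shows "entries A = xs"
proof -
  have "sorted_wrt (<) (rev xs)" using assms(1) by (simp add: sorted_wrt_rev)
  then have "sorted (rev xs)" "distinct (rev xs)" by (simp_all add: strict_sorted_iff)
  then have "sorted_list_of_set (set (rev xs)) = rev xs"
    by (rule sorted_list_of_set.idem_if_sorted_distinct)
  then show ?thesis
    using assms(2) by (simp add: entries_def sorted_list_of_fset.rep_eq)
qed

lemma entries_shift: "entries (shift A) = map Suc (entries A) @ [0]"
  by (rule entries_unique)
     (auto simp: shift_def sorted_wrt_append sorted_wrt_map sorted_entries)

lemma fcard_shift [simp]: "fcard (shift A) = Suc (fcard A)"
  using length_entries[of "shift A"] by (simp add: entries_shift)

lemma sum_shift: "(\<Sum>a\<in>fset (shift A). f a) = f 0 + (\<Sum>a\<in>fset A. f (Suc a))"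
  by (simp add: shift_def sum.reindex image_iff)

lift_definition rank :: "symbol \<Rightarrow> int" is
  "\<lambda>(A, B). int (\<Sum>a\<in>fset A. a) + int (\<Sum>b\<in>fset B. b)
     - \<lfloor>((real (fcard A + fcard B) - 1) / 2)\<^sup>2\<rfloor>"
proof (rule equivclp_shift_step_invariant, assumption)
  fix A B :: beta_set
  have "((real (fcard (shift A) + fcard (shift B)) - 1) / 2)\<^sup>2
      = ((real (fcard A + fcard B) - 1) / 2)\<^sup>2 + of_int (int (fcard A + fcard B))"
    by (simp add: power2_eq_square field_simps)
  then have floor_shift: "\<lfloor>((real (fcard (shift A) + fcard (shift B)) - 1) / 2)\<^sup>2\<rfloor>
      = \<lfloor>((real (fcard A + fcard B) - 1) / 2)\<^sup>2\<rfloor> + int (fcard A + fcard B)"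
    by (simp only: floor_add_int)
  have "(\<Sum>x\<in>fset (shift X). x) = (\<Sum>x\<in>fset X. x) + fcard X" for X
    by (simp add: sum_shift sum_Suc fcard.rep_eq)
  then show "int (\<Sum>a\<in>fset (shift A). a) + int (\<Sum>b\<in>fset (shift B). b)
       - \<lfloor>((real (fcard (shift A) + fcard (shift B)) - 1) / 2)\<^sup>2\<rfloor>
     = int (\<Sum>a\<in>fset A. a) + int (\<Sum>b\<in>fset B. b)
       - \<lfloor>((real (fcard A + fcard B) - 1) / 2)\<^sup>2\<rfloor>"
    unfolding floor_shift by (simp del: of_nat_sum)
qed

lift_definition defect :: "symbol \<Rightarrow> int" is "\<lambda>(A, B). int (fcard A) - int (fcard B)"
  by (rule equivclp_shift_step_invariant, assumption) simp

definition symbols :: "nat \<Rightarrow> int \<Rightarrow> symbol set" where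
  "symbols n \<delta> = {\<Lambda>. rank \<Lambda> = int n \<and> defect \<Lambda> = \<delta>}"

section \<open>Bi-partitions\<close>

text \<open>
  A partition up to trailing zeros is the multiset of its non-zero parts;
  \<open>part \<alpha> k\<close> is the part usually written \<open>\<alpha>\<^sub>k\<^sub>+\<^sub>1\<close>, and is 0 beyond the length.
\<close>

type_synonym partition = "nat multiset"

definition parts :: "partition \<Rightarrow> nat list" where
  "parts \<alpha> = rev (sorted_list_of_multiset \<alpha>)"

definition part :: "partition \<Rightarrow> nat \<Rightarrow> nat" where
  "part \<alpha> k = (if k < size \<alpha> then parts \<alpha> ! k else 0)"

definition partition_of :: "nat list \<Rightarrow> partition" where
  "partition_of xs = filter_mset (\<lambda>x. 0 < x) (mset xs)"

text \<open>
  Since the parts are positive and decreasing, a proper prefix is smaller in \<open>lexord\<close>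
  precisely as it is when both sequences are padded with zeros.
\<close>

definition lex_less :: "partition \<Rightarrow> partition \<Rightarrow> bool" where
  "lex_less \<alpha> \<beta> \<longleftrightarrow> (parts \<alpha>, parts \<beta>) \<in> lexord {(x, y). x < y}"

definition beta_partition :: "beta_set \<Rightarrow> partition" where
  "beta_partition A =
     partition_of (map (\<lambda>k. entries A ! k - (fcard A - 1 - k)) [0..<fcard A])"

lemma beta_partition_shift: "beta_partition (shift A) = beta_partition A"
proof -
  have map_eq: "map (\<lambda>k. entries (shift A) ! k - (fcard (shift A) - 1 - k)) [0..<fcard (shift A)]
      = map (\<lambda>k. entries A ! k - (fcard A - 1 - k)) [0..<fcard A] @ [0]"
    by (auto simp: entries_shift nth_append)
  show ?thesis
    unfolding beta_partition_def map_eq by (simp add: partition_of_def)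
qed

lift_definition Upsilon :: "symbol \<Rightarrow> partition \<times> partition" is
  "\<lambda>(A, B). (beta_partition A, beta_partition B)"
  by (rule equivclp_shift_step_invariant, assumption) (simp add: beta_partition_shift)

abbreviation upper :: "symbol \<Rightarrow> partition" where "upper \<Lambda> \<equiv> fst (Upsilon \<Lambda>)"
abbreviation lower :: "symbol \<Rightarrow> partition" where "lower \<Lambda> \<equiv> snd (Upsilon \<Lambda>)"

section \<open>Groups\<close>

datatype sign = Plus | Minus
datatype family = Sp | Orth sign

text \<open>The symbols parametrizing the unipotent characters of the group of rank \<open>n\<close>.\<close>

definition symbols_of :: "family \<Rightarrow> nat \<Rightarrow> symbol set" where
  "symbols_of G n = {\<Lambda>. rank \<Lambda> = int n \<and>
     defect \<Lambda> mod 4 = (case G of Sp \<Rightarrow> 1 | Orth Plus \<Rightarrow> 0 | Orth Minus \<Rightarrow> 2)}"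

definition weighted_sum :: "beta_set \<Rightarrow> nat" where
  "weighted_sum A = (\<Sum>k<fcard A. (fcard A - 1 - k) * entries A ! k)"

definition binomial_tail :: "nat \<Rightarrow> nat" where
  "binomial_tail m = (\<Sum>j\<in>{j. 1 \<le> j \<and> 2 * j \<le> m}. (m - 2 * j) choose 2)"

lemma weighted_sum_shift:
  "weighted_sum (shift A) = weighted_sum A + (\<Sum>a\<in>fset A. a) + fcard A + (fcard A choose 2)"
proof -
  let ?m = "fcard A" and ?e = "\<lambda>k. entries A ! k"
  have "distinct (entries A)"
    by (simp add: entries_def sorted_list_of_fset.rep_eq)
  then have entries_sum: "(\<Sum>k<?m. ?e k) = (\<Sum>a\<in>fset A. a)"
    by (metis atLeast0LessThan length_entries map_ident set_entries sum.distinct_set_conv_list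
        sum_list_sum_nth)
  have triangle: "(\<Sum>k<m. m - k) = m + (m choose 2)" for m :: nat
  proof (induction m)
    case (Suc m)
    have "(\<Sum>k<Suc m. Suc m - k) = Suc m + (\<Sum>k<m. m - k)"
      by (subst sum.lessThan_Suc_shift) simp
    then show ?case using Suc by (simp add: numeral_2_eq_2)
  qed simp
  have "weighted_sum (shift A) = (\<Sum>k<?m. (?m - k) * Suc (?e k))"
    by (simp add: weighted_sum_def entries_shift nth_append)
  also have "\<dots> = (\<Sum>k<?m. (?m - 1 - k) * ?e k + ?e k + (?m - k))"
  proof (rule sum.cong[OF refl])
    fix k assume "k \<in> {..<?m}"
    then obtain j where "?m = Suc (k + j)" using less_imp_Suc_add by auto
    then show "(?m - k) * Suc (?e k) = (?m - 1 - k) * ?e k + ?e k + (?m - k)"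
      by simp
  qed
  finally show ?thesis
    by (simp only: sum.distrib entries_sum triangle weighted_sum_def[of A] add.assoc)
qed

lemma binomial_tail_Suc_Suc: "binomial_tail (Suc (Suc m)) = (m choose 2) + binomial_tail m"
proof -
  have "{j. 1 \<le> j \<and> 2 * j \<le> Suc (Suc m)} = insert 1 (Suc ` {j. 1 \<le> j \<and> 2 * j \<le> m})"
    (is "?L = ?R")
  proof
    show "?L \<subseteq> ?R"
    proof
      fix j assume "j \<in> ?L"
      then show "j \<in> ?R" by (cases j; cases "j = 1") auto
    qed
  qed auto
  moreover have "finite {j. 1 \<le> j \<and> 2 * j \<le> m}"
    by (rule finite_subset[of _ "{..m}"]) auto
  ultimately show ?thesis
    by (simp add: binomial_tail_def sum.reindex image_iff)
qed

lemma max_sum_shift: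
  "(\<Sum>a\<in>fset (shift A). \<Sum>b\<in>fset (shift B). max a b)
     = (\<Sum>a\<in>fset A. \<Sum>b\<in>fset B. max a b) + (\<Sum>a\<in>fset A. a) + (\<Sum>b\<in>fset B. b)
       + fcard A + fcard B + fcard A * fcard B"
  by (simp add: sum_shift sum_Suc sum.distrib fcard.rep_eq del: sum.insert)

text \<open>\<open>ord_sum\<close> is the order without its leading term \<open>N\<close>.\<close>

lift_definition ord_sum :: "symbol \<Rightarrow> int" is
  "\<lambda>(A, B). int (weighted_sum A) + int (weighted_sum B)
     + int (\<Sum>a\<in>fset A. \<Sum>b\<in>fset B. max a b)
     - int (\<Sum>a\<in>fset A. a * (a + 1)) - int (\<Sum>b\<in>fset B. b * (b + 1))
     - int (binomial_tail (fcard A + fcard B))"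
proof (rule equivclp_shift_step_invariant, assumption)
  fix A B :: beta_set
  have choose: "(k + l) choose 2 = (k choose 2) + (l choose 2) + k * l" for k l :: nat
    by (induction k) (simp_all add: numeral_2_eq_2)
  have square: "(\<Sum>x\<in>fset (shift X). x * (x + 1))
      = (\<Sum>x\<in>fset X. x * (x + 1)) + 2 * (\<Sum>x\<in>fset X. x) + 2 * fcard X" for X
    by (simp add: sum_shift sum.distrib sum_Suc fcard.rep_eq flip: sum_distrib_left)
  show "int (weighted_sum (shift A)) + int (weighted_sum (shift B))
       + int (\<Sum>a\<in>fset (shift A). \<Sum>b\<in>fset (shift B). max a b)
       - int (\<Sum>a\<in>fset (shift A). a * (a + 1)) - int (\<Sum>b\<in>fset (shift B). b * (b + 1))
       - int (binomial_tail (fcard (shift A) + fcard (shift B)))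
     = int (weighted_sum A) + int (weighted_sum B)
       + int (\<Sum>a\<in>fset A. \<Sum>b\<in>fset B. max a b)
       - int (\<Sum>a\<in>fset A. a * (a + 1)) - int (\<Sum>b\<in>fset B. b * (b + 1))
       - int (binomial_tail (fcard A + fcard B))"
    unfolding weighted_sum_shift max_sum_shift square fcard_shift
      add_Suc add_Suc_right binomial_tail_Suc_Suc choose
    by (simp del: of_nat_sum of_nat_mult)
qed

definition symbol_ord :: "family \<Rightarrow> symbol \<Rightarrow> int" where
  "symbol_ord G \<Lambda> =
     (case G of Sp \<Rightarrow> rank \<Lambda> * (rank \<Lambda> + 1) | Orth _ \<Rightarrow> (rank \<Lambda>)\<^sup>2) + ord_sum \<Lambda>"

section \<open>The correspondence\<close>

definition dual_defect :: "sign \<Rightarrow> int \<Rightarrow> int" where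
  "dual_defect \<epsilon> \<delta> = (case \<epsilon> of Plus \<Rightarrow> - \<delta> + 1 | Minus \<Rightarrow> - \<delta> - 1)"

text \<open>
  The defect is \<open>4 d + 1\<close>, \<open>4 d\<close> or \<open>4 d + 2\<close> according to the group, so
  \<open>d = \<delta> div 4\<close> in all cases (\<open>div\<close> on integers rounds down).
\<close>

definition tau :: "sign \<Rightarrow> nat \<Rightarrow> nat \<Rightarrow> int \<Rightarrow> int" where
  "tau \<epsilon> n n' \<delta> = (let d = \<delta> div 4 in
     case \<epsilon> of Plus \<Rightarrow> int n' - int n + 2 * d | Minus \<Rightarrow> int n' - int n - 1 - 2 * d)"

definition interlaces :: "partition \<Rightarrow> partition \<Rightarrow> bool" where
  "interlaces \<beta> \<alpha> \<longleftrightarrow> (\<forall>k. part \<alpha> (Suc k) \<le> part \<beta> k \<and> part \<beta> k \<le> part \<alpha> k)"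

definition Theta :: "sign \<Rightarrow> nat \<Rightarrow> symbol \<Rightarrow> symbol set" where
  "Theta \<epsilon> n' \<Lambda> = {\<Lambda>' \<in> symbols n' (dual_defect \<epsilon> (defect \<Lambda>)).
     (case \<epsilon> of
        Plus \<Rightarrow> interlaces (lower \<Lambda>) (upper \<Lambda>') \<and> interlaces (lower \<Lambda>') (upper \<Lambda>)
      | Minus \<Rightarrow> interlaces (upper \<Lambda>) (lower \<Lambda>') \<and> interlaces (upper \<Lambda>') (lower \<Lambda>))}"

text \<open>
  The union with the one-row partition \<open>[\<tau>]\<close> is a sum of multisets;
  \<open>partition_of\<close> discards the part \<open>\<tau>\<close> when it is 0.
\<close>

definition theta_under :: "sign \<Rightarrow> nat \<Rightarrow> symbol \<Rightarrow> symbol" where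
  "theta_under \<epsilon> n' \<Lambda> =
     (let row = partition_of [nat (tau \<epsilon> (nat (rank \<Lambda>)) n' (defect \<Lambda>))] in
      THE \<Lambda>'. \<Lambda>' \<in> symbols n' (dual_defect \<epsilon> (defect \<Lambda>)) \<and>
        Upsilon \<Lambda>' = (case \<epsilon> of
            Plus \<Rightarrow> (lower \<Lambda> + row, upper \<Lambda>)
          | Minus \<Rightarrow> (lower \<Lambda>, upper \<Lambda> + row)))"

definition prec_by ::
    "(symbol \<Rightarrow> partition) \<Rightarrow> (symbol \<Rightarrow> partition) \<Rightarrow> symbol \<Rightarrow> symbol \<Rightarrow> bool" where
  "prec_by f g \<Lambda> \<Lambda>' \<longleftrightarrow>
     sum_mset (f \<Lambda>) < sum_mset (f \<Lambda>') \<or>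
     sum_mset (f \<Lambda>) = sum_mset (f \<Lambda>') \<and>
       (lex_less (f \<Lambda>) (f \<Lambda>') \<or> f \<Lambda> = f \<Lambda>' \<and> lex_less (g \<Lambda>) (g \<Lambda>'))"

text \<open>\<open>prec \<epsilon>\<close> is the strict linear order on the symbols of given rank and defect.\<close>

definition prec :: "sign \<Rightarrow> symbol \<Rightarrow> symbol \<Rightarrow> bool" where
  "prec \<epsilon> = (case \<epsilon> of Plus \<Rightarrow> prec_by upper lower | Minus \<Rightarrow> prec_by lower upper)"

definition least_symbol :: "sign \<Rightarrow> symbol set \<Rightarrow> symbol" where
  "least_symbol \<epsilon> X = (THE \<Lambda>. \<Lambda> \<in> X \<and> (\<forall>\<Lambda>'\<in>X. \<Lambda>' \<noteq> \<Lambda> \<longrightarrow> prec \<epsilon> \<Lambda> \<Lambda>'))"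

definition max_ord :: "family \<Rightarrow> symbol set \<Rightarrow> symbol set" where
  "max_ord G X = {\<Lambda> \<in> X. \<forall>\<Lambda>'\<in>X. symbol_ord G \<Lambda>' \<le> symbol_ord G \<Lambda>}"

lemma mset_parts [simp]: "mset (parts \<alpha>) = \<alpha>"
  by (simp add: parts_def)

lemma sorted_parts: "sorted_wrt (\<ge>) (parts \<alpha>)"
  by (simp add: parts_def sorted_wrt_rev sorted_sorted_list_of_multiset)

lemma lex_less_imp_less:
  assumes "lex_less \<alpha> \<beta>"
  shows "\<alpha> < \<beta>"
proof -
  from assms consider
    (prefix) a v where "parts \<beta> = parts \<alpha> @ a # v"
  | (differ) u a b v w where "a < b" "parts \<alpha> = u @ a # v" "parts \<beta> = u @ b # w"
    unfolding lex_less_def lexord_def by blast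
  then show ?thesis
  proof cases
    case prefix
    then have "mset (parts \<beta>) = \<alpha> + mset (a # v)" by (metis mset_append mset_parts)
    then show ?thesis by (simp add: subset_imp_less_mset subset_mset.less_le)
  next
    case differ
    have "\<forall>x\<in>set v. x \<le> a"
      using sorted_parts[of \<alpha>] differ by (simp add: sorted_wrt_append)
    then have "mset (a # v) < mset (b # w)"
      using differ(1) by (intro ex_gt_imp_less_multiset exI[of _ b]) auto
    then have "mset u + mset (a # v) < mset u + mset (b # w)"
      by (rule add_strict_left_mono)
    then show ?thesis by (metis differ(2,3) mset_append mset_parts)
  qed
qed

lemma wf_prec_by: "wf {(\<Lambda>, \<Lambda>'). prec_by f g \<Lambda> \<Lambda>'}"
proof (rule wf_subset)
  show "wf (inv_image (less_than <*lex*> {(M :: partition, N). M < N} <*lex*> {(M, N). M < N})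
              (\<lambda>\<Lambda>. (sum_mset (f \<Lambda>), f \<Lambda>, g \<Lambda>)))"
    by (intro wf_inv_image wf_lex_prod wf_less_than wf_less_multiset)
  show "{(\<Lambda>, \<Lambda>'). prec_by f g \<Lambda> \<Lambda>'} \<subseteq> \<dots>"
    by (auto simp: prec_by_def dest: lex_less_imp_less)
qed

lemma wf_prec: "wf {(\<Lambda>, \<Lambda>'). prec \<epsilon> \<Lambda> \<Lambda>'}"
  by (cases \<epsilon>) (simp_all add: prec_def wf_prec_by)

text \<open>
  The recursion runs over the smaller symbols of the same rank and defect;
  \<open>G'\<close> only selects the leading term of the order.
\<close>

function theta_over :: "sign \<Rightarrow> family \<Rightarrow> nat \<Rightarrow> symbol \<Rightarrow> symbol" where
  "theta_over \<epsilon> G' n' \<Lambda> =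
     least_symbol \<epsilon> (max_ord G'
       (Theta \<epsilon> n' \<Lambda> - theta_over \<epsilon> G' n' `
          {\<Lambda>\<^sub>1. rank \<Lambda>\<^sub>1 = rank \<Lambda> \<and> defect \<Lambda>\<^sub>1 = defect \<Lambda> \<and> prec \<epsilon> \<Lambda>\<^sub>1 \<Lambda>}))"
  by pat_completeness auto
termination
proof (relation "same_fst (\<lambda>_. True) (\<lambda>\<epsilon>. same_fst (\<lambda>_. True) (\<lambda>_. same_fst (\<lambda>_. True)
    (\<lambda>_. {(\<Lambda>, \<Lambda>'). prec \<epsilon> \<Lambda> \<Lambda>'})))")
  show "wf (same_fst (\<lambda>_. True) (\<lambda>\<epsilon>. same_fst (\<lambda>_. True) (\<lambda>_. same_fst (\<lambda>_. True)
    (\<lambda>_. {(\<Lambda>, \<Lambda>'). prec \<epsilon> \<Lambda> \<Lambda>'}))))"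
    by (intro wf_same_fst wf_prec)
qed (simp add: same_fst_def)

declare theta_over.simps [simp del]

end

theory Submission
  imports Defs
begin

text \<open>
  The map of the theorem exchanges the two rows of a symbol, shifting one of them so that
  the defect comes out as \<open>dual_defect\<close>; call it \<open>exchange \<epsilon>\<close>.  On bi-partitions it simply swaps
  the two components, and it is an involution on the set of all symbols.  When \<open>\<tau> = 0\<close> it matches
  rank \<open>n\<close> in defect \<open>\<delta>\<close> with rank \<open>n'\<close> (\<open>rank_exchange\<close>), so every candidate image \<open>\<Lambda>'\<close> is
  \<open>exchange \<epsilon> \<Lambda>\<^sub>1\<close> for some symbol \<open>\<Lambda>\<^sub>1\<close> with the rank and defect of \<open>\<Lambda>\<close>.

  The heart of the proof is \<open>Theta_exchange_imp_eq_or_prec\<close>.  Call major the component of the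
  bi-partition that the linear order compares first, and minor the other.  If
  \<open>exchange \<epsilon> \<Lambda>\<^sub>1\<close> lies in \<open>\<Theta>(\<Lambda>)\<close>, then interlacing says in particular that the major partition
  of \<open>\<Lambda>\<^sub>1\<close> is contained in that of \<open>\<Lambda>\<close>, and the minor partition of \<open>\<Lambda>\<close> in that of \<open>\<Lambda>\<^sub>1\<close>.
  Both bi-partitions have the same total size.  Hence either the major partition of \<open>\<Lambda>\<^sub>1\<close> is
  strictly smaller in size, so that \<open>\<Lambda>\<^sub>1\<close> precedes \<open>\<Lambda>\<close>, or both containments are equalities and
  \<open>\<Lambda>\<^sub>1 = \<Lambda>\<close>.

  By induction along the order, the images already used up by the predecessors of \<open>\<Lambda>\<close> are their
  exchanges.  Removing them from \<open>\<Theta>(\<Lambda>)\<close> leaves only \<open>exchange \<epsilon> \<Lambda>\<close>, which is therefore the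
  value of \<open>theta_over\<close>.
\<close>

section \<open>Partitions with equal or comparable parts\<close>

lemma part_Suc_le: "part \<alpha> (Suc k) \<le> part \<alpha> k"
proof -
  have "length (parts \<alpha>) = size \<alpha>" by (metis mset_parts size_mset)
  then show ?thesis
    using sorted_parts[of \<alpha>] by (auto simp: part_def sorted_wrt_iff_nth_less)
qed

lemma interlaces_refl: "interlaces \<alpha> \<alpha>"
  by (simp add: interlaces_def part_Suc_le)

lemma mset_map_part: "mset (map (part \<alpha>) [0..<size \<alpha>]) = \<alpha>"
proof -
  have "length (parts \<alpha>) = size \<alpha>" by (metis mset_parts size_mset)
  then have "map (part \<alpha>) [0..<size \<alpha>] = parts \<alpha>"
    by (intro nth_equalityI) (auto simp: part_def)
  then show ?thesis by simp
qed

lemma sum_mset_conv_part: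
  assumes "size \<alpha> \<le> N"
  shows "sum_mset \<alpha> = (\<Sum>k<N. part \<alpha> k)"
proof -
  have "sum_mset \<alpha> = sum_list (map (part \<alpha>) [0..<size \<alpha>])"
    by (metis mset_map_part sum_mset_sum_list)
  also have "\<dots> = (\<Sum>k<size \<alpha>. part \<alpha> k)"
    by (simp add: interv_sum_list_conv_sum_set_nat atLeast0LessThan)
  also have "\<dots> = (\<Sum>k<N. part \<alpha> k)"
    by (rule sum.mono_neutral_left) (use assms in \<open>auto simp: part_def\<close>)
  finally show ?thesis .
qed

text \<open>
  A partition is recovered from its sequence of parts padded with zeros.  Padding puts two
  partitions of different lengths on a common index range, where they can be compared.
\<close>

lemma partition_of_map_part:
  assumes "0 \<notin># \<alpha>" "size \<alpha> \<le> N"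
  shows "partition_of (map (part \<alpha>) [0..<N]) = \<alpha>"
proof -
  have split: "[0..<N] = [0..<size \<alpha>] @ [size \<alpha>..<N]"
    using assms(2) by (metis le_add_diff_inverse upt_add_eq_append zero_le)
  have zero: "filter_mset (\<lambda>x. 0 < x) (mset (map (part \<alpha>) [size \<alpha>..<N])) = {#}"
  proof -
    have "map (part \<alpha>) [size \<alpha>..<N] = replicate (N - size \<alpha>) 0"
      by (rule nth_equalityI) (auto simp: part_def)
    then show ?thesis by simp
  qed
  have pos: "filter_mset (\<lambda>x. 0 < x) \<alpha> = \<alpha>"
    using assms(1) by (metis filter_mset_True filter_mset_cong neq0_conv)
  have "partition_of (map (part \<alpha>) [0..<N])
      = filter_mset (\<lambda>x. 0 < x) (mset (map (part \<alpha>) [0..<size \<alpha>]))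
        + filter_mset (\<lambda>x. 0 < x) (mset (map (part \<alpha>) [size \<alpha>..<N]))"
    unfolding partition_of_def split map_append mset_append filter_union_mset ..
  then show ?thesis unfolding mset_map_part zero pos by simp
qed

lemma sum_mset_mono_part:
  assumes "\<And>k. part \<alpha> k \<le> part \<beta> k"
  shows "sum_mset \<alpha> \<le> sum_mset \<beta>"
proof -
  have "sum_mset \<alpha> = (\<Sum>k<max (size \<alpha>) (size \<beta>). part \<alpha> k)"
    by (rule sum_mset_conv_part) simp
  also have "\<dots> \<le> (\<Sum>k<max (size \<alpha>) (size \<beta>). part \<beta> k)"
    by (rule sum_mono) (rule assms)
  also have "\<dots> = sum_mset \<beta>"
    by (rule sum_mset_conv_part[symmetric]) simp
  finally show ?thesis .
qed

text \<open>
  Containment of Young diagrams of equal size is equality.  The parts must be positive, since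
  zeros in a multiset are invisible to both \<open>part\<close> and the sum.
\<close>

lemma partition_eqI:
  assumes le: "\<And>k. part \<alpha> k \<le> part \<beta> k"
    and sum: "sum_mset \<alpha> = sum_mset \<beta>"
    and "0 \<notin># \<alpha>" "0 \<notin># \<beta>"
  shows "\<alpha> = \<beta>"
proof -
  let ?N = "max (size \<alpha>) (size \<beta>)"
  have "(\<Sum>k<?N. part \<alpha> k) = (\<Sum>k<?N. part \<beta> k)"
    using sum by (metis max.cobounded1 max.cobounded2 sum_mset_conv_part)
  then have "part \<alpha> k = part \<beta> k" if "k < ?N" for k
    using sum_mono_inv[of "part \<alpha>" "{..<?N}" "part \<beta>" k] le that by simp
  then have "map (part \<alpha>) [0..<?N] = map (part \<beta>) [0..<?N]" by simp
  then show ?thesis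
    using assms(3,4) by (metis max.cobounded1 max.cobounded2 partition_of_map_part)
qed

section \<open>Beta-sets and their partitions\<close>

text \<open>
  The partition of a beta-set with its trailing zeros kept: the entries minus the staircase
  \<open>m - 1, \<dots>, 1, 0\<close>.
\<close>

definition staircase_diff :: "beta_set \<Rightarrow> nat list" where
  "staircase_diff A = map (\<lambda>k. entries A ! k - (fcard A - 1 - k)) [0..<fcard A]"

lemma beta_partition_conv_staircase_diff:
  "beta_partition A = partition_of (staircase_diff A)"
  by (simp add: beta_partition_def staircase_diff_def)

lemma length_staircase_diff [simp]: "length (staircase_diff A) = fcard A"
  by (simp add: staircase_diff_def)

lemma zero_notin_beta_partition: "0 \<notin># beta_partition A"
  by (simp add: beta_partition_def partition_of_def)

lemma strictly_decreasing_nth_ge: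
  fixes xs :: "nat list"
  assumes "sorted_wrt (>) xs" "k < length xs"
  shows "length xs - 1 - k \<le> xs ! k"
  using assms
proof (induction xs arbitrary: k)
  case (Cons x xs)
  show ?case
  proof (cases k)
    case 0
    show ?thesis
    proof (cases xs)
      case (Cons y ys)
      have "length xs - 1 - 0 \<le> xs ! 0" using Cons.IH[of 0] Cons.prems Cons by simp
      moreover have "y < x" using Cons.prems Cons by simp
      ultimately show ?thesis using 0 Cons by simp
    qed (simp add: 0)
  next
    case (Suc j)
    then show ?thesis using Cons.IH[of j] Cons.prems by simp
  qed
qed simp

text \<open>
  This bound makes the truncated subtractions in \<open>staircase_diff\<close> genuine ones.
\<close>

lemma entries_nth_ge: "k < fcard A \<Longrightarrow> fcard A - 1 - k \<le> entries A ! k"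
  using strictly_decreasing_nth_ge[OF sorted_entries, of k A] by simp

lemma sorted_staircase_diff: "sorted_wrt (\<ge>) (staircase_diff A)"
proof -
  have "entries A ! Suc k - (fcard A - 1 - Suc k) \<le> entries A ! k - (fcard A - 1 - k)"
    if "Suc k < fcard A" for k
  proof -
    have "entries A ! Suc k < entries A ! k"
      using sorted_entries[of A] that by (auto simp: sorted_wrt_iff_nth_less)
    with that show ?thesis by linarith
  qed
  then show ?thesis
    by (subst sorted_wrt_iff_nth_Suc_transp) (auto simp: staircase_diff_def transp_def)
qed

lemma sum_mset_partition_of: "sum_mset (partition_of xs) = sum_list xs"
  by (induction xs) (auto simp: partition_of_def)

lemma sum_mset_beta_partition:
  "sum_mset (beta_partition A) + (\<Sum>k<fcard A. fcard A - 1 - k) = (\<Sum>a\<in>fset A. a)"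
proof -
  have "sum_mset (beta_partition A) = (\<Sum>k<fcard A. entries A ! k - (fcard A - 1 - k))"
    by (simp add: beta_partition_conv_staircase_diff sum_mset_partition_of staircase_diff_def
        interv_sum_list_conv_sum_set_nat atLeast0LessThan)
  then have "sum_mset (beta_partition A) + (\<Sum>k<fcard A. fcard A - 1 - k)
      = (\<Sum>k<fcard A. entries A ! k)"
    by (simp only: sum.distrib[symmetric]) (intro sum.cong[OF refl] le_add_diff_inverse2 entries_nth_ge, simp)
  also have "\<dots> = (\<Sum>a\<in>fset A. a)"
  proof -
    have "distinct (entries A)" by (simp add: entries_def sorted_list_of_fset.rep_eq)
    then show ?thesis
      by (metis atLeast0LessThan length_entries map_ident set_entries
          sum.distinct_set_conv_list sum_list_sum_nth)
  qed
  finally show ?thesis .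
qed

text \<open>
  The cardinality tells how many zeros were discarded, so the whole decreasing list
  \<open>staircase_diff A\<close> can be rebuilt; adding the staircase back gives the entries.
\<close>

lemma beta_partition_inject:
  assumes "beta_partition A = beta_partition B" and card: "fcard A = fcard B"
  shows "A = B"
proof -
  have decomp: "mset xs = partition_of xs + replicate_mset (length xs - size (partition_of xs)) 0"
    for xs
  proof (induction xs)
    case (Cons x xs)
    have "size (partition_of xs) \<le> length xs"
      unfolding partition_of_def by (metis size_filter_mset_lesseq size_mset)
    with Cons show ?case by (auto simp: partition_of_def Suc_diff_le)
  qed (simp add: partition_of_def)
  have "mset (staircase_diff A) = mset (staircase_diff B)"
    using assms by (subst (1 2) decomp) (simp add: beta_partition_conv_staircase_diff)
  then have "rev (staircase_diff A) = rev (staircase_diff B)"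
    using sorted_staircase_diff[of A] sorted_staircase_diff[of B]
    by (metis mset_rev properties_for_sort sorted_wrt_rev)
  then have eq: "staircase_diff A = staircase_diff B" by simp
  have "entries A = entries B"
  proof (rule nth_equalityI)
    fix k assume "k < length (entries A)"
    then have k: "k < fcard A" by simp
    have "staircase_diff A ! k = staircase_diff B ! k" using eq by simp
    with k card entries_nth_ge[OF k] entries_nth_ge[of k B]
    show "entries A ! k = entries B ! k" by (simp add: staircase_diff_def)
  qed (simp add: card)
  then show ?thesis by (metis fset_inject set_entries)
qed

section \<open>Symbols with a given rank and defect\<close>

lemma Symbol_shift: "Symbol (shift A) (shift B) = Symbol A B"
  by transfer (meson equivclp_sym r_into_equivclp shift_step.intros)

lemma Symbol_cases: obtains A B where "\<Lambda> = Symbol A B"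
  by transfer (metis equivclp_refl prod.exhaust)

lemma Symbol_shift_funpow: "Symbol ((shift ^^ k) A) ((shift ^^ k) B) = Symbol A B"
  by (induction k) (simp_all add: Symbol_shift)

lemma fcard_shift_funpow: "fcard ((shift ^^ k) A) = k + fcard A"
  by (induction k) simp_all

lemma Upsilon_Symbol: "Upsilon (Symbol A B) = (beta_partition A, beta_partition B)"
  by transfer simp

lemma defect_Symbol: "defect (Symbol A B) = int (fcard A) - int (fcard B)"
  by transfer simp

lemma rank_Symbol:
  "rank (Symbol A B) = int (\<Sum>a\<in>fset A. a) + int (\<Sum>b\<in>fset B. b)
     - \<lfloor>((real (fcard A + fcard B) - 1) / 2)\<^sup>2\<rfloor>"
  by transfer simp

text \<open>
  Shifting each symbol as often as the upper row of the other one has entries makes the upper rows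
  equally long; the lower rows then agree in length because the defects do.  For such
  representatives, every quantity that depends only on the cardinalities cancels.
\<close>

lemma common_cardinalities:
  assumes "defect \<Lambda> = defect \<Lambda>'"
  obtains A B A' B' where "\<Lambda> = Symbol A B" "\<Lambda>' = Symbol A' B'"
    "fcard A = fcard A'" "fcard B = fcard B'"
proof -
  obtain A B where \<Lambda>: "\<Lambda> = Symbol A B" by (rule Symbol_cases)
  obtain A' B' where \<Lambda>': "\<Lambda>' = Symbol A' B'" by (rule Symbol_cases)
  show ?thesis
  proof (rule that)
    show "\<Lambda> = Symbol ((shift ^^ fcard A') A) ((shift ^^ fcard A') B)"
      by (simp add: \<Lambda> Symbol_shift_funpow)
    show "\<Lambda>' = Symbol ((shift ^^ fcard A) A') ((shift ^^ fcard A) B')"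
      by (simp add: \<Lambda>' Symbol_shift_funpow)
  qed (use assms in \<open>auto simp: \<Lambda> \<Lambda>' defect_Symbol fcard_shift_funpow\<close>)
qed

lemma symbol_eqI:
  assumes "defect \<Lambda> = defect \<Lambda>'" "Upsilon \<Lambda> = Upsilon \<Lambda>'"
  shows "\<Lambda> = \<Lambda>'"
  using assms(1)
proof (rule common_cardinalities)
  fix A B A' B'
  assume "\<Lambda> = Symbol A B" "\<Lambda>' = Symbol A' B'" "fcard A = fcard A'" "fcard B = fcard B'"
  with assms(2) show ?thesis by (auto simp: Upsilon_Symbol dest: beta_partition_inject)
qed

text \<open>
  For representatives with common cardinalities, the staircases and the correction term of the
  rank are the same on both sides, so equal ranks leave equal sizes of the bi-partitions.
\<close>

lemma size_Upsilon_eq: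
  assumes "defect \<Lambda> = defect \<Lambda>'" "rank \<Lambda> = rank \<Lambda>'"
  shows "sum_mset (upper \<Lambda>) + sum_mset (lower \<Lambda>) = sum_mset (upper \<Lambda>') + sum_mset (lower \<Lambda>')"
  using assms(1)
proof (rule common_cardinalities)
  fix A B A' B'
  assume *: "\<Lambda> = Symbol A B" "\<Lambda>' = Symbol A' B'" "fcard A = fcard A'" "fcard B = fcard B'"
  have "(\<Sum>a\<in>fset A. a) + (\<Sum>b\<in>fset B. b) = (\<Sum>a\<in>fset A'. a) + (\<Sum>b\<in>fset B'. b)"
    using assms(2) unfolding * rank_Symbol by linarith
  then show ?thesis
    using sum_mset_beta_partition[of A] sum_mset_beta_partition[of B]
      sum_mset_beta_partition[of A'] sum_mset_beta_partition[of B']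
    unfolding * Upsilon_Symbol by simp
qed

lemma zero_notin_Upsilon: "0 \<notin># upper \<Lambda>" "0 \<notin># lower \<Lambda>"
  by (rule Symbol_cases[of \<Lambda>], simp add: Upsilon_Symbol zero_notin_beta_partition)+

section \<open>Exchanging the rows\<close>

text \<open>
  The two signs correspond to each other under swapping the rows of the symbols.
\<close>

lift_definition exchange :: "sign \<Rightarrow> symbol \<Rightarrow> symbol" is
  "\<lambda>\<epsilon> (A, B). case \<epsilon> of Plus \<Rightarrow> (shift B, A) | Minus \<Rightarrow> (B, shift A)"
proof -
  fix \<epsilon> and x y :: "beta_set \<times> beta_set"
  assume *: "equivclp shift_step x y"
  define f where "f A B = (case \<epsilon> of Plus \<Rightarrow> Symbol (shift B) A | Minus \<Rightarrow> Symbol B (shift A))"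
    for A B
  have "case_prod f x = case_prod f y"
    using * by (rule equivclp_shift_step_invariant) (simp add: f_def Symbol_shift split: sign.split)
  then show "equivclp shift_step
      (case x of (A, B) \<Rightarrow> case \<epsilon> of Plus \<Rightarrow> (shift B, A) | Minus \<Rightarrow> (B, shift A))
      (case y of (A, B) \<Rightarrow> case \<epsilon> of Plus \<Rightarrow> (shift B, A) | Minus \<Rightarrow> (B, shift A))"
    by (cases x; cases y; cases \<epsilon>)
       (simp_all add: f_def Symbol.abs_eq symbol.abs_eq_iff)
qed

lemma exchange_Symbol:
  "exchange \<epsilon> (Symbol A B) = (case \<epsilon> of Plus \<Rightarrow> Symbol (shift B) A | Minus \<Rightarrow> Symbol B (shift A))"
  by (cases \<epsilon>) (simp_all, (transfer, simp)+)

lemma Upsilon_exchange: "Upsilon (exchange \<epsilon> \<Lambda>) = (lower \<Lambda>, upper \<Lambda>)"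
  by (rule Symbol_cases[of \<Lambda>])
     (simp add: exchange_Symbol Upsilon_Symbol beta_partition_shift split: sign.split)

lemma defect_exchange: "defect (exchange \<epsilon> \<Lambda>) = dual_defect \<epsilon> (defect \<Lambda>)"
  by (rule Symbol_cases[of \<Lambda>])
     (simp add: exchange_Symbol defect_Symbol dual_defect_def split: sign.split)

lemma exchange_exchange: "exchange \<epsilon> (exchange \<epsilon> \<Lambda>) = \<Lambda>"
  by (rule Symbol_cases[of \<Lambda>]) (simp add: exchange_Symbol Symbol_shift split: sign.split)

text \<open>
  Exchanging rows increases the number of entries by one; this is the resulting change in the
  correction term of the rank.
\<close>

lemma floor_quarter_square:
  "\<lfloor>(real m / 2)\<^sup>2\<rfloor> = \<lfloor>((real m - 1) / 2)\<^sup>2\<rfloor> + int (m div 2)"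
proof (cases "even m")
  case True
  then obtain k where m: "m = 2 * k" by (rule evenE)
  have "\<lfloor>(real m / 2)\<^sup>2\<rfloor> = int k * int k"
    by (rule floor_unique) (simp_all add: m power2_eq_square)
  moreover have "\<lfloor>((real m - 1) / 2)\<^sup>2\<rfloor> = int k * int k - int k"
    by (rule floor_unique) (simp_all add: m power2_eq_square field_simps)
  ultimately show ?thesis by (simp add: m)
next
  case False
  then obtain k where m: "m = 2 * k + 1" by (rule oddE)
  have "\<lfloor>(real m / 2)\<^sup>2\<rfloor> = int k * int k + int k"
    by (rule floor_unique) (simp_all add: m power2_eq_square field_simps)
  moreover have "\<lfloor>((real m - 1) / 2)\<^sup>2\<rfloor> = int k * int k"
    by (rule floor_unique) (simp_all add: m power2_eq_square)
  ultimately show ?thesis by (simp add: m)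
qed

lemma rank_exchange:
  "rank (exchange \<epsilon> \<Lambda>) = rank \<Lambda> +
     (case \<epsilon> of Plus \<Rightarrow> - (defect \<Lambda> div 2) | Minus \<Rightarrow> defect \<Lambda> - defect \<Lambda> div 2)"
proof (rule Symbol_cases[of \<Lambda>])
  fix A B assume \<Lambda>: "\<Lambda> = Symbol A B"
  let ?m = "fcard A + fcard B"
  have sum_shift_id: "(\<Sum>x\<in>fset (shift X). x) = (\<Sum>x\<in>fset X. x) + fcard X" for X
    by (simp add: sum_shift sum_Suc fcard.rep_eq)
  have half: "int (?m div 2) = defect \<Lambda> div 2 + int (fcard B)"
    by (simp add: \<Lambda> defect_Symbol)
  have "rank (exchange \<epsilon> \<Lambda>) = int (\<Sum>a\<in>fset A. a) + int (\<Sum>b\<in>fset B. b)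
      + int (case \<epsilon> of Plus \<Rightarrow> fcard B | Minus \<Rightarrow> fcard A) - \<lfloor>(real ?m / 2)\<^sup>2\<rfloor>"
    by (cases \<epsilon>) (simp_all add: \<Lambda> exchange_Symbol rank_Symbol sum_shift_id add.commute
        del: of_nat_sum)
  then show ?thesis
    unfolding floor_quarter_square half
    by (cases \<epsilon>) (simp_all add: \<Lambda> rank_Symbol defect_Symbol del: of_nat_sum)
qed

section \<open>The recursion\<close>

text \<open>
  The component of the bi-partition that \<open>prec \<epsilon>\<close> compares first, and the other one.  In these
  terms both signs have the same interlacing conditions and the same order.
\<close>

definition major :: "sign \<Rightarrow> symbol \<Rightarrow> partition" where
  "major \<epsilon> \<Lambda> = (case \<epsilon> of Plus \<Rightarrow> upper \<Lambda> | Minus \<Rightarrow> lower \<Lambda>)"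

definition minor :: "sign \<Rightarrow> symbol \<Rightarrow> partition" where
  "minor \<epsilon> \<Lambda> = (case \<epsilon> of Plus \<Rightarrow> lower \<Lambda> | Minus \<Rightarrow> upper \<Lambda>)"

lemma major_exchange: "major \<epsilon> (exchange \<epsilon>' \<Lambda>) = minor \<epsilon> \<Lambda>"
  and minor_exchange: "minor \<epsilon> (exchange \<epsilon>' \<Lambda>) = major \<epsilon> \<Lambda>"
  by (simp_all add: major_def minor_def Upsilon_exchange split: sign.split)

lemma Theta_iff:
  "\<Lambda>' \<in> Theta \<epsilon> n' \<Lambda> \<longleftrightarrow> \<Lambda>' \<in> symbols n' (dual_defect \<epsilon> (defect \<Lambda>))
     \<and> interlaces (minor \<epsilon> \<Lambda>) (major \<epsilon> \<Lambda>') \<and> interlaces (minor \<epsilon> \<Lambda>') (major \<epsilon> \<Lambda>)"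
  by (simp add: Theta_def major_def minor_def split: sign.split)

lemma prec_if_smaller_major:
  "sum_mset (major \<epsilon> \<Lambda>) < sum_mset (major \<epsilon> \<Lambda>') \<Longrightarrow> prec \<epsilon> \<Lambda> \<Lambda>'"
  by (cases \<epsilon>) (simp_all add: prec_def prec_by_def major_def)

text \<open>
  The upper bounds in the interlacing conditions say that, in passing from \<open>\<Lambda>\<close> to \<open>\<Lambda>\<^sub>1\<close>, the major
  partition can only lose boxes and the minor one can only gain them.  Equal rank and defect fix
  the total, so either the major partition shrinks or nothing moves.
\<close>

lemma Theta_exchange_imp_eq_or_prec:
  assumes "defect \<Lambda>\<^sub>1 = defect \<Lambda>" "rank \<Lambda>\<^sub>1 = rank \<Lambda>"
    and "exchange \<epsilon> \<Lambda>\<^sub>1 \<in> Theta \<epsilon> n' \<Lambda>"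
  shows "\<Lambda>\<^sub>1 = \<Lambda> \<or> prec \<epsilon> \<Lambda>\<^sub>1 \<Lambda>"
proof (cases "sum_mset (major \<epsilon> \<Lambda>\<^sub>1) < sum_mset (major \<epsilon> \<Lambda>)")
  case True
  then show ?thesis by (simp add: prec_if_smaller_major)
next
  case False
  have le: "part (major \<epsilon> \<Lambda>\<^sub>1) k \<le> part (major \<epsilon> \<Lambda>) k"
    "part (minor \<epsilon> \<Lambda>) k \<le> part (minor \<epsilon> \<Lambda>\<^sub>1) k" for k
    using assms(3) by (simp_all add: Theta_iff major_exchange minor_exchange interlaces_def)
  have pos: "0 \<notin># major \<epsilon> X" "0 \<notin># minor \<epsilon> X" for X
    by (simp_all add: major_def minor_def zero_notin_Upsilon split: sign.split)
  have total: "sum_mset (major \<epsilon> \<Lambda>\<^sub>1) + sum_mset (minor \<epsilon> \<Lambda>\<^sub>1)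
      = sum_mset (major \<epsilon> \<Lambda>) + sum_mset (minor \<epsilon> \<Lambda>)"
    using size_Upsilon_eq[OF assms(1,2)] by (cases \<epsilon>) (simp_all add: major_def minor_def)
  have sum: "sum_mset (major \<epsilon> \<Lambda>\<^sub>1) = sum_mset (major \<epsilon> \<Lambda>)"
    using False sum_mset_mono_part[OF le(1)] by simp
  then have "major \<epsilon> \<Lambda>\<^sub>1 = major \<epsilon> \<Lambda>"
    using le(1) pos by (intro partition_eqI) auto
  moreover have "minor \<epsilon> \<Lambda> = minor \<epsilon> \<Lambda>\<^sub>1"
    using le(2) pos sum total by (intro partition_eqI) auto
  ultimately have "Upsilon \<Lambda>\<^sub>1 = Upsilon \<Lambda>"
    by (cases \<epsilon>) (simp_all add: major_def minor_def prod_eq_iff)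
  then show ?thesis using assms(1) by (simp add: symbol_eqI)
qed

lemma max_ord_singleton: "max_ord G {\<Lambda>} = {\<Lambda>}"
  by (auto simp: max_ord_def)

lemma least_symbol_singleton: "least_symbol \<epsilon> {\<Lambda>} = \<Lambda>"
  by (auto simp: least_symbol_def)

text \<open>
  The symbols removed from \<open>\<Theta>(\<Lambda>)\<close> are, by induction, the exchanges of the predecessors of
  \<open>\<Lambda>\<close>, and what remains is a singleton.
\<close>

lemma theta_over_eq_exchange:
  assumes rank_dual: "\<And>\<Lambda>. defect \<Lambda> = \<delta> \<Longrightarrow> rank (exchange \<epsilon> \<Lambda>) = int n' \<longleftrightarrow> rank \<Lambda> = int n"
    and "\<Lambda> \<in> symbols n \<delta>"
  shows "theta_over \<epsilon> G' n' \<Lambda> = exchange \<epsilon> \<Lambda>"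
  using assms(2)
proof (induction \<Lambda> rule: wf_induct_rule[OF wf_prec[of \<epsilon>]])
  case (1 \<Lambda>)
  then have \<Lambda>: "rank \<Lambda> = int n" "defect \<Lambda> = \<delta>" by (simp_all add: symbols_def)
  let ?below = "{\<Lambda>\<^sub>1. rank \<Lambda>\<^sub>1 = rank \<Lambda> \<and> defect \<Lambda>\<^sub>1 = defect \<Lambda> \<and> prec \<epsilon> \<Lambda>\<^sub>1 \<Lambda>}"
  have below: "theta_over \<epsilon> G' n' ` ?below = exchange \<epsilon> ` ?below"
    by (rule image_cong[OF refl]) (auto intro!: "1.IH" simp: symbols_def \<Lambda>)
  have "Theta \<epsilon> n' \<Lambda> - exchange \<epsilon> ` ?below = {exchange \<epsilon> \<Lambda>}"
  proof (rule Set.set_eqI, rule iffI)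
    fix \<Lambda>' assume *: "\<Lambda>' \<in> Theta \<epsilon> n' \<Lambda> - exchange \<epsilon> ` ?below"
    \<comment> \<open>Every symbol is an exchange; here of a symbol with the rank and defect of \<open>\<Lambda>\<close>.\<close>
    obtain \<Lambda>\<^sub>1 where \<Lambda>\<^sub>1: "\<Lambda>' = exchange \<epsilon> \<Lambda>\<^sub>1" by (metis exchange_exchange)
    have "dual_defect \<epsilon> (defect \<Lambda>\<^sub>1) = dual_defect \<epsilon> \<delta>"
      using * by (simp add: Theta_iff symbols_def \<Lambda> \<Lambda>\<^sub>1 defect_exchange)
    then have d: "defect \<Lambda>\<^sub>1 = \<delta>" by (simp add: dual_defect_def split: sign.splits)
    have r: "rank \<Lambda>\<^sub>1 = int n"
      using * rank_dual[OF d] by (simp add: Theta_iff symbols_def \<Lambda>\<^sub>1)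
    have "\<Lambda>\<^sub>1 = \<Lambda> \<or> prec \<epsilon> \<Lambda>\<^sub>1 \<Lambda>"
      using * by (intro Theta_exchange_imp_eq_or_prec[where n' = n']) (auto simp: \<Lambda> d r \<Lambda>\<^sub>1)
    moreover have "\<not> prec \<epsilon> \<Lambda>\<^sub>1 \<Lambda>" using * by (auto simp: \<Lambda> d r \<Lambda>\<^sub>1)
    ultimately show "\<Lambda>' \<in> {exchange \<epsilon> \<Lambda>}" by (simp add: \<Lambda>\<^sub>1)
  next
    fix \<Lambda>' assume "\<Lambda>' \<in> {exchange \<epsilon> \<Lambda>}"
    then have \<Lambda>': "\<Lambda>' = exchange \<epsilon> \<Lambda>" by simp
    \<comment> \<open>The exchange of \<open>\<Lambda>\<close> is still available, for no symbol precedes itself.\<close>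
    have "exchange \<epsilon> \<Lambda> \<noteq> exchange \<epsilon> \<Lambda>\<^sub>1" if "\<Lambda>\<^sub>1 \<in> ?below" for \<Lambda>\<^sub>1
    proof
      assume "exchange \<epsilon> \<Lambda> = exchange \<epsilon> \<Lambda>\<^sub>1"
      then have "Upsilon \<Lambda> = Upsilon \<Lambda>\<^sub>1"
        using Upsilon_exchange[of \<epsilon> \<Lambda>] Upsilon_exchange[of \<epsilon> \<Lambda>\<^sub>1] by (simp add: prod_eq_iff)
      then have "\<Lambda> = \<Lambda>\<^sub>1" using that by (intro symbol_eqI) simp_all
      then show False using that wf_irrefl[OF wf_prec[of \<epsilon>]] by auto
    qed
    then show "\<Lambda>' \<in> Theta \<epsilon> n' \<Lambda> - exchange \<epsilon> ` ?below"
      by (auto simp: \<Lambda>' Theta_iff symbols_def defect_exchange rank_dual \<Lambda> major_exchange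
          minor_exchange interlaces_refl)
  qed
  then show ?case
    unfolding theta_over.simps[of \<epsilon> G' n' \<Lambda>] below
    by (simp add: max_ord_singleton least_symbol_singleton)
qed

lemma theta_under_eq_exchange:
  assumes "exchange \<epsilon> \<Lambda> \<in> symbols n' (dual_defect \<epsilon> (defect \<Lambda>))"
    and "tau \<epsilon> (nat (rank \<Lambda>)) n' (defect \<Lambda>) = 0"
  shows "theta_under \<epsilon> n' \<Lambda> = exchange \<epsilon> \<Lambda>"
proof -
  have row: "partition_of [nat (tau \<epsilon> (nat (rank \<Lambda>)) n' (defect \<Lambda>))] = {#}"
    by (simp add: assms(2) partition_of_def)
  have target: "(case \<epsilon> of Plus \<Rightarrow> (lower \<Lambda> + {#}, upper \<Lambda>) | Minus \<Rightarrow> (lower \<Lambda>, upper \<Lambda> + {#}))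
      = Upsilon (exchange \<epsilon> \<Lambda>)"
    by (simp add: Upsilon_exchange split: sign.split)
  show ?thesis
    unfolding theta_under_def Let_def row target
    by (rule the_equality)
       (use assms(1) in \<open>auto simp: symbols_def intro: symbol_eqI\<close>)
qed

theorem corollary5p3:
  fixes n n' :: nat and \<delta> :: int and \<epsilon> :: sign and G G' :: family
  assumes "G = Orth \<epsilon> \<and> G' = Sp \<or> G = Sp \<and> G' = Orth \<epsilon>"
    and "symbols n \<delta> \<subseteq> symbols_of G n"
    and "tau \<epsilon> n n' \<delta> = 0"
  shows "theta_over \<epsilon> G' n' ` symbols n \<delta> \<subseteq> symbols n' (dual_defect \<epsilon> \<delta>)
    \<and> (\<forall>A B. Symbol A B \<in> symbols n \<delta> \<longrightarrow>
         theta_over \<epsilon> G' n' (Symbol A B) =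
           (case \<epsilon> of
              Plus \<Rightarrow> Symbol (finsert 0 ((\<lambda>b. b + 1) |`| B)) A
            | Minus \<Rightarrow> Symbol B (finsert 0 ((\<lambda>a. a + 1) |`| A))))
    \<and> (\<forall>\<Lambda>\<in>symbols n \<delta>. theta_under \<epsilon> n' \<Lambda> = theta_over \<epsilon> G' n' \<Lambda>)"
proof (cases "symbols n \<delta> = {}")
  case True
  then show ?thesis by auto
next
  case False
  then have "\<delta> mod 4 = (case G of Sp \<Rightarrow> 1 | Orth Plus \<Rightarrow> 0 | Orth Minus \<Rightarrow> 2)"
    using assms(2) by (auto simp: symbols_def symbols_of_def)
  then have *: "case \<epsilon> of Plus \<Rightarrow> \<delta> mod 4 \<in> {0, 1} | Minus \<Rightarrow> \<delta> mod 4 \<in> {1, 2}"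
    using assms(1) by (cases \<epsilon>) auto
  \<comment> \<open>The congruence on the defect turns \<open>\<tau> = 0\<close> into the rank change under \<open>exchange\<close>.\<close>
  have n': "int n' = int n + (case \<epsilon> of Plus \<Rightarrow> - (\<delta> div 2) | Minus \<Rightarrow> \<delta> - \<delta> div 2)"
  proof (cases \<epsilon>)
    case Plus
    with assms(3) have "int n' - int n + 2 * (\<delta> div 4) = 0" by (simp add: tau_def Let_def)
    moreover have "\<delta> div 2 = 2 * (\<delta> div 4)" if "\<delta> mod 4 = 0 \<or> \<delta> mod 4 = 1"
      using that by presburger
    ultimately show ?thesis using Plus * by simp
  next
    case Minus
    with assms(3) have "int n' - int n - 1 - 2 * (\<delta> div 4) = 0" by (simp add: tau_def Let_def)
    moreover have "\<delta> - \<delta> div 2 = 2 * (\<delta> div 4) + 1" if "\<delta> mod 4 = 1 \<or> \<delta> mod 4 = 2"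
      using that by presburger
    ultimately show ?thesis using Minus * by simp
  qed
  then have rank_dual: "rank (exchange \<epsilon> \<Lambda>) = int n' \<longleftrightarrow> rank \<Lambda> = int n" if "defect \<Lambda> = \<delta>" for \<Lambda>
    unfolding rank_exchange that using n' by simp
  have over: "theta_over \<epsilon> G' n' \<Lambda> = exchange \<epsilon> \<Lambda>" if "\<Lambda> \<in> symbols n \<delta>" for \<Lambda>
    using rank_dual that by (rule theta_over_eq_exchange)
  have dual: "exchange \<epsilon> \<Lambda> \<in> symbols n' (dual_defect \<epsilon> \<delta>)" if "\<Lambda> \<in> symbols n \<delta>" for \<Lambda>
    using that rank_dual by (simp add: symbols_def defect_exchange)
  have under: "theta_under \<epsilon> n' \<Lambda> = exchange \<epsilon> \<Lambda>" if "\<Lambda> \<in> symbols n \<delta>" for \<Lambda>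
    using that dual[OF that] assms(3) by (intro theta_under_eq_exchange) (simp_all add: symbols_def)
  show ?thesis
    using over dual under by (auto simp: exchange_Symbol shift_def split: sign.split)
qed

end
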